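(* Let $m \leq n$, let $A$ be a real $m \times n$ matrix with rows $A_1, \dots, A_m$ (regarded as column vectors in $\mathbb{R}^n$), let $b \in \mathbb{R}^m$, and suppose that $\operatorname{rank}(A) = m$. Let $x_{LS}$ be the minimal Euclidean norm solution of $Ax = b$, let $x^0 \in \mathbb{R}^n$, and write $$P_{\mathcal{R}(A^T)}(x^0) - x_{LS} = \sum_{i=1}^m \gamma_i A_i, \qquad \gamma_i \in \mathbb{R}.$$ If $\gamma_i > 0$ for all $i = 1, \dots, m$, then for the MRK algorithm started at $x^0$, with projection indices $(i_k)_{k \geq 0}$, every row index is selected at least once, that is, $$\forall i \in \{1, 2, \dots, m\}, \ \exists k \geq 0 \text{ such that } i_k = i.$$
   Context: $\langle \cdot, \cdot\rangle$ and $\|\cdot\|$ denote the Euclidean scalar product and norm. $\mathcal{R}(A^T) = \operatorname{span}\{A_1, \dots, A_m\} \subseteq \mathbb{R}^n$ is the range of $A^T$, and $P_V$ denotes the orthogonal (metric) projection onto a nonempty closed convex set $V$. The vector $x_{LS}$ belongs to $\mathcal{R}(A^T)$. The MRK algorithm (Kaczmarz algorithm with Maximal Residual control, also called remotest set control) for the system $Ax = b$ is the following. Initialization: $x^0 \in \mathbb{R}^n$. Iterative step: for $k = 0, 1, 2, \dots$, select an index $i_k \in \{1, \dots, m\}$ such that $$|\langle x^k, A_{i_k}\rangle - b_{i_k}| = \max_{1 \leq i \leq m} |\langle x^k, A_i\rangle - b_i|$$ (any maximizing index may be selected), and set $$x^{k+1} = x^k - \frac{\langle x^k, A_{i_k}\rangle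 - b_{i_k}}{\|A_{i_k}\|^2} A_{i_k},$$ i.e. $x^{k+1}$ is the orthogonal projection of $x^k$ onto the hyperplane $H_{i_k} = \{x \in \mathbb{R}^n : \langle x, A_{i_k}\rangle = b_{i_k}\}$. The iteration is carried out for all $k \geq 0$. *)

theory Defs
  imports "HOL-Analysis.Analysis"
begin

definition min_norm_solution :: "real^'n^'m \<Rightarrow> real^'m \<Rightarrow> real^'n \<Rightarrow> bool" where
  "min_norm_solution A b z \<longleftrightarrow> is_arg_min norm (\<lambda>x. A *v x = b) z"

definition residual :: "real^'n^'m \<Rightarrow> real^'m \<Rightarrow> real^'n \<Rightarrow> 'm \<Rightarrow> real" where
  "residual A b x j = x \<bullet> row j A - b $ j"

text \<open>The maximizing index need not be unique, so a run of the Kaczmarz algorithm with maximal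
  residual control is a relation between the starting point, the iterates \<open>x\<close> and the
  selected indices \<open>idx\<close>: every admissible way of breaking ties is a run.\<close>

definition MRK_run ::
  "real^'n^'m \<Rightarrow> real^'m \<Rightarrow> real^'n \<Rightarrow> (nat \<Rightarrow> real^'n) \<Rightarrow> (nat \<Rightarrow> 'm) \<Rightarrow> bool" where
  "MRK_run A b x0 x idx \<longleftrightarrow>
     x 0 = x0 \<and>
     (\<forall>k. \<bar>residual A b (x k) (idx k)\<bar> = Max (range (\<lambda>j. \<bar>residual A b (x k) j\<bar>)) \<and>
          x (Suc k) = x k - (residual A b (x k) (idx k) / (norm (row (idx k) A))\<^sup>2) *\<^sub>R row (idx k) A)"

end

theory Submission
  imports Defs
begin

text \<open>Since the rows are linearly independent, each index \<open>i\<close> has a dual vector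
  \<open>w = A\<^sup>T y\<close> in the row space, with \<open>\<langle>w, A\<^sub>j\<rangle> = 1\<close> for \<open>j = i\<close> and \<open>0\<close> otherwise
  (\<open>gram_surjective\<close>). Pairing with \<open>w\<close> reads off the coefficient of \<open>A\<^sub>i\<close>. A Kaczmarz step moves the
  iterate along the selected row only, so if \<open>i\<close> is never selected, then \<open>\<langle>x\<^sup>k - x\<^sub>L\<^sub>S, w\<rangle>\<close> keeps
  its initial value (\<open>MRK_step_preserves_dual\<close>), and this value is \<open>\<gamma>\<^sub>i\<close>, because the projection
  onto the row space does not change the pairing with \<open>w\<close>
  (\<open>closest_point_subspace_orthogonal\<close>).

  On the other hand \<open>\<langle>x\<^sup>k - x\<^sub>L\<^sub>S, w\<rangle> = \<langle>A x\<^sup>k - b, y\<rangle>\<close>, and maximal residual control forces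
  every residual to tend to \<open>0\<close> (\<open>MRK_residual_tendsto_0\<close>). Hence \<open>\<gamma>\<^sub>i = 0\<close>, a contradiction.\<close>

text \<open>The matrix \<open>A A\<^sup>T\<close> is square, and its kernel is that of \<open>A\<^sup>T\<close> because
  \<open>\<langle>A A\<^sup>T y, y\<rangle> = \<parallel>A\<^sup>T y\<parallel>\<^sup>2\<close>.\<close>

lemma gram_surjective:
  fixes A :: "real^'n^'m"
  assumes "rank A = CARD('m)"
  obtains y where "A *v (transpose A *v y) = c"
proof -
  have inj_T: "inj ((*v) (transpose A))"
    using assms by (simp add: full_rank_injective[symmetric] rank_transpose)
  let ?G = "\<lambda>y. A *v (transpose A *v y)"
  have lin: "linear ?G"
    by (simp only: matrix_vector_mul_assoc matrix_vector_mul_linear)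
  have "y = 0" if "?G y = 0" for y
  proof -
    have "(transpose A *v y) \<bullet> (transpose A *v y) = ?G y \<bullet> y"
      by (metis dot_lmul_matrix inner_commute vector_transpose_matrix transpose_transpose
          transpose_matrix_vector)
    then have "transpose A *v y = transpose A *v 0"
      using that by simp
    then show "y = 0"
      using inj_T by (rule injD[rotated])
  qed
  then have "inj ?G"
    using lin by (simp add: linear_injective_0)
  then have "surj ?G"
    using lin linear_injective_imp_surjective by blast
  then show ?thesis
    using that by (metis surjD)
qed

lemma closest_point_subspace_orthogonal:
  fixes S :: "'a::euclidean_space set"
  assumes "subspace S" "w \<in> S"
  shows "(a - closest_point S a) \<bullet> w = 0"
proof -
  let ?p = "closest_point S a"
  have closed: "closed S" and convex: "convex S"
    using assms(1) by (auto simp: closed_subspace subspace_imp_convex)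
  have p: "?p \<in> S"
    using closed assms(2) closest_point_in_set by blast
  \<comment> \<open>The variational inequality at \<open>p + w\<close> and at \<open>p - w\<close> gives both signs.\<close>
  have "(a - ?p) \<bullet> ((?p + w) - ?p) \<le> 0"
    using closest_point_dot[OF convex closed] subspace_add[OF assms(1) p assms(2)] by blast
  moreover have "(a - ?p) \<bullet> ((?p - w) - ?p) \<le> 0"
    using closest_point_dot[OF convex closed] subspace_diff[OF assms(1) p assms(2)] by blast
  ultimately show ?thesis
    by (simp add: algebra_simps)
qed

lemma residual_eq_inner_diff:
  assumes "A *v z = b"
  shows "residual A b v j = (v - z) \<bullet> row j A"
  using assms[symmetric]
  by (simp add: residual_def matrix_vector_mul_component row_def inner_diff_left inner_diff_right inner_commute)

text \<open>By Pythagoras, the step \<open>k\<close> lowers the squared distance to any fixed solution by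
  \<open>r\<^sub>k\<^sup>2 / \<parallel>A\<^bsub>i\<^sub>k\<^esub>\<parallel>\<^sup>2\<close>, where \<open>r\<^sub>k\<close> is the selected residual. The squared distances converge, so
  these decrements vanish in the limit; the selected residual being the largest in modulus, all
  the others vanish with it.\<close>

lemma MRK_residual_tendsto_0:
  fixes A :: "real^'n^'m"
  assumes sol: "A *v z = b" and nz: "\<And>j. row j A \<noteq> 0" and run: "MRK_run A b x0 x idx"
  shows "(\<lambda>k. residual A b (x k) j) \<longlonglongrightarrow> 0"
proof -
  define D where "D k = (norm (x k - z))\<^sup>2" for k
  define r where "r k = residual A b (x k) (idx k)" for k
  define M where "M = (\<Sum>j\<in>UNIV. (norm (row j A))\<^sup>2)"
  have decrease: "(r k)\<^sup>2 = (D k - D (Suc k)) * (norm (row (idx k) A))\<^sup>2" for k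
  proof -
    let ?a = "row (idx k) A"
    let ?t = "r k / (norm ?a)\<^sup>2"
    have "x (Suc k) - z = (x k - z) - ?t *\<^sub>R ?a"
      using run by (simp add: MRK_run_def r_def)
    moreover have "(norm (u - t *\<^sub>R a))\<^sup>2 = (norm u)\<^sup>2 - 2 * t * (u \<bullet> a) + t\<^sup>2 * (norm a)\<^sup>2"
      for u a :: "real^'n" and t
      unfolding power2_norm_eq_inner
      by (simp add: inner_diff inner_commute power2_eq_square algebra_simps)
    ultimately have "D (Suc k) = D k - 2 * ?t * ((x k - z) \<bullet> ?a) + ?t\<^sup>2 * (norm ?a)\<^sup>2"
      unfolding D_def by metis
    moreover have "(x k - z) \<bullet> ?a = r k"
      by (simp add: r_def residual_eq_inner_diff[OF sol])
    ultimately show ?thesis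
      using nz[of "idx k"] by (simp add: field_simps power2_eq_square)
  qed
  have D_Suc: "D (Suc k) \<le> D k" for k
  proof -
    have "0 \<le> (D k - D (Suc k)) * (norm (row (idx k) A))\<^sup>2"
      using decrease[of k] by (metis zero_le_power2)
    then show ?thesis
      using nz[of "idx k"] by (simp add: zero_le_mult_iff)
  qed
  have "convergent D"
  proof (rule Bseq_monoseq_convergent)
    show "monoseq D"
      using D_Suc by (simp add: monoseq_Suc)
    then show "Bseq D"
      using decseq_bounded[of D 0] D_Suc by (simp add: decseq_Suc_iff D_def)
  qed
  then obtain L where L: "D \<longlonglongrightarrow> L"
    by (auto simp: convergent_def)
  have "(\<lambda>k. (D k - D (Suc k)) * M) \<longlonglongrightarrow> (L - L) * M"
    by (intro tendsto_intros L LIMSEQ_Suc)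
  then have lim: "(\<lambda>k. (D k - D (Suc k)) * M) \<longlonglongrightarrow> 0"
    by simp
  have bound: "(residual A b (x k) j)\<^sup>2 \<le> (D k - D (Suc k)) * M" for k
  proof -
    have "\<bar>residual A b (x k) j\<bar> \<le> Max (range (\<lambda>j. \<bar>residual A b (x k) j\<bar>))"
      by (rule Max_ge) auto
    also have "\<dots> = \<bar>r k\<bar>"
      using run by (simp add: MRK_run_def r_def)
    finally have "(residual A b (x k) j)\<^sup>2 \<le> (r k)\<^sup>2"
      by (simp add: abs_le_square_iff)
    also have "\<dots> \<le> (D k - D (Suc k)) * M"
      unfolding decrease M_def using D_Suc[of k]
      by (intro mult_left_mono member_le_sum) auto
    finally show ?thesis .
  qed
  have "(\<lambda>k. (residual A b (x k) j)\<^sup>2) \<longlonglongrightarrow> 0"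
    by (rule tendsto_sandwich[OF _ _ tendsto_const lim]) (auto simp: bound)
  then show ?thesis
    by simp
qed

lemma MRK_step_preserves_dual:
  assumes "MRK_run A b x0 x idx" and "row (idx k) A \<bullet> w = 0"
  shows "x (Suc k) \<bullet> w = x k \<bullet> w"
  using assms by (simp add: MRK_run_def inner_diff_left)

theorem proposition1:
  fixes A :: "real^'n^'m" and b :: "real^'m"
    and xLS x0 :: "real^'n" and \<gamma> :: "'m \<Rightarrow> real"
    and x :: "nat \<Rightarrow> real^'n" and idx :: "nat \<Rightarrow> 'm"
  assumes "CARD('m) \<le> CARD('n)"
    and "rank A = CARD('m)"
    and "min_norm_solution A b xLS"
    and "closest_point (range (\<lambda>y. transpose A *v y)) x0 - xLS = (\<Sum>i\<in>UNIV. \<gamma> i *\<^sub>R row i A)"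
    and "\<forall>i. \<gamma> i > 0"
    and "MRK_run A b x0 x idx"
  shows "\<forall>i. \<exists>k. idx k = i"
proof (rule allI, rule ccontr)
  fix i
  assume "\<nexists>k. idx k = i"
  then have never: "idx k \<noteq> i" for k
    by blast
  have sol: "A *v xLS = b"
    using assms(3) by (simp add: min_norm_solution_def is_arg_min_def)
  have row_inner: "row j A \<bullet> v = (A *v v) $ j" for j v
    by (simp add: matrix_vector_mul_component row_def)
  have nz: "row j A \<noteq> 0" for j
  proof
    assume "row j A = 0"
    moreover obtain y where "A *v (transpose A *v y) = axis j 1"
      using gram_surjective[OF assms(2)] .
    ultimately show False
      using row_inner[of j "transpose A *v y"] by simp
  qed
  obtain y where y: "A *v (transpose A *v y) = axis i 1"
    using gram_surjective[OF assms(2)] .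
  define w where "w = transpose A *v y"
  have dual: "row j A \<bullet> w = (if j = i then 1 else 0)" for j
    unfolding row_inner w_def y by (simp add: axis_def)
  let ?R = "range (\<lambda>y. transpose A *v y)"
  have "subspace ?R"
    by (intro linear_subspace_image matrix_vector_mul_linear subspace_UNIV)
  moreover have "w \<in> ?R"
    by (simp add: w_def)
  ultimately have "(x0 - closest_point ?R x0) \<bullet> w = 0"
    by (rule closest_point_subspace_orthogonal)
  then have "(x0 - xLS) \<bullet> w = (closest_point ?R x0 - xLS) \<bullet> w"
    by (simp add: inner_diff_left)
  also have "\<dots> = \<gamma> i"
    unfolding assms(4) by (simp add: inner_sum_left dual if_distrib cong: if_cong)
  finally have init: "(x0 - xLS) \<bullet> w = \<gamma> i" .
  have const: "(x k - xLS) \<bullet> w = \<gamma> i" for k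
  proof (induction k)
    case 0
    then show ?case
      using assms(6) init by (simp add: MRK_run_def)
  next
    case (Suc k)
    then show ?case
      using MRK_step_preserves_dual[OF assms(6), of k w] never[of k]
      by (simp add: dual inner_diff_left)
  qed
  have w_rows: "w = (\<Sum>j\<in>UNIV. y $ j *\<^sub>R row j A)"
    by (simp add: w_def matrix_mult_sum column_transpose scalar_mult_eq_scaleR)
  have "(x k - xLS) \<bullet> w = (\<Sum>j\<in>UNIV. y $ j * residual A b (x k) j)" for k
    by (simp add: w_rows inner_sum_right residual_eq_inner_diff[OF sol])
  moreover have "(\<lambda>k. \<Sum>j\<in>UNIV. y $ j * residual A b (x k) j) \<longlonglongrightarrow> (\<Sum>j\<in>UNIV. y $ j * 0)"
    by (intro tendsto_intros MRK_residual_tendsto_0[OF sol nz assms(6)])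
  ultimately have "(\<lambda>k. \<gamma> i) \<longlonglongrightarrow> 0"
    by (simp add: const)
  then have "\<gamma> i = 0"
    by (simp add: LIMSEQ_const_iff)
  then show False
    using assms(5) by (metis less_irrefl)
qed

end
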